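(* Let $\alpha>0$, $1\le p<\infty$, $f\in F_\alpha^p$, and let $n\ge1$ be an integer. Then $$|f^{(n)}(0)|\le\frac{(\alpha p)^{\frac n2}\,n!}{2^{\frac n2}\,\Gamma\left(1+\frac{np}{2}\right)^{1/p}}\,\|f\|_{p,\alpha}.$$ The extremal functions (those for which equality holds) are those of the form $f(w)=Aw^n$, where $A$ is an arbitrary complex constant.
   Context: For $\alpha>0$ and $1\le p<\infty$, for measurable $f$ on $\mathbb{C}$, $$\|f\|_{p,\alpha}^p=\frac{p\alpha}{2\pi}\int_{\mathbb{C}}|f(z)|^p e^{-\frac{p\alpha|z|^2}{2}}\,dA(z),$$ where $dA$ is Lebesgue measure on $\mathbb{C}$. The Fock space $F_\alpha^p$ is the space of all entire functions $f$ with $\|f\|_{p,\alpha}<\infty$. $f^{(n)}$ denotes the $n$-th complex derivative. *)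

theory Defs
  imports "HOL-Complex_Analysis.Complex_Analysis"
begin

text \<open>
  The \<open>p\<close>-th power of the norm is a nonnegative Lebesgue integral and takes the value
  \<open>\<infinity>\<close> when the integral diverges.
\<close>

definition fock_norm_pow :: "real \<Rightarrow> real \<Rightarrow> (complex \<Rightarrow> complex) \<Rightarrow> ennreal" where
  "fock_norm_pow \<alpha> p f =
     ennreal (p * \<alpha> / (2 * pi)) *
     (\<integral>\<^sup>+ z. ennreal (norm (f z) powr p * exp (- (p * \<alpha> * (norm z)\<^sup>2 / 2))) \<partial>lebesgue)"

text \<open>
  The norm as a real number. It is meaningful only when \<^const>\<open>fock_norm_pow\<close> is finite,
  because \<^const>\<open>enn2real\<close> maps \<open>\<infinity>\<close> to \<open>0\<close>.
\<close>

definition fock_norm :: "real \<Rightarrow> real \<Rightarrow> (complex \<Rightarrow> complex) \<Rightarrow> real" where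
  "fock_norm \<alpha> p f = enn2real (fock_norm_pow \<alpha> p f) powr (1 / p)"

definition fock_space :: "real \<Rightarrow> real \<Rightarrow> (complex \<Rightarrow> complex) set" where
  "fock_space \<alpha> p = {f. f holomorphic_on UNIV \<and> fock_norm_pow \<alpha> p f < \<infinity>}"

end

theory Submission
  imports Defs
begin

text \<open>
  Let \<open>a\<close> be the \<open>n\<close>-th Taylor coefficient of \<open>f\<close>. By Cauchy's formula, \<open>f(z e\<^sup>i\<^sup>t) e\<^sup>-\<^sup>i\<^sup>n\<^sup>t\<close> has mean
  \<open>a z\<^sup>n\<close> over \<open>t\<close>, so integrating the tangent plane inequality \<open>1 + p (Re w - 1) \<le> |w|\<^sup>p\<close> shows that
  the circular means of \<open>|f|\<^sup>p\<close> dominate \<open>|a z\<^sup>n|\<^sup>p\<close>. Since the Gaussian weight and Lebesgue measure are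
  rotation invariant, the norm of \<open>a z\<^sup>n\<close> is at most that of \<open>f\<close>; it is a Gamma integral because
  \<open>|z|\<^sup>2\<close> pushes Lebesgue measure forward to \<open>\<pi>\<close> times Lebesgue measure on the half-line. Equality
  forces \<open>f(z) / (a z\<^sup>n)\<close> to be real almost everywhere, hence everywhere off \<open>0\<close>, hence constant by the open
  mapping theorem.
\<close>

section \<open>Lebesgue measure on the plane in Cartesian coordinates\<close>

lemma borel_measurable_Complex [measurable]:
  "(\<lambda>(x, y). Complex x y) \<in> borel_measurable (lborel \<Otimes>\<^sub>M lborel)"
proof -
  have "(\<lambda>w. complex_of_real (fst w) + \<i> * complex_of_real (snd w)) \<in> borel_measurable borel"
    by (intro borel_measurable_continuous_onI continuous_intros)
  then show ?thesis
    by (simp add: lborel_prod Complex_eq case_prod_unfold)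
qed

text \<open>Lebesgue measure is determined by its values on boxes, and a complex box is a product of
  two intervals.\<close>

lemma lborel_complex_eq_distr:
  "(lborel :: complex measure) = distr (lborel \<Otimes>\<^sub>M lborel) borel (\<lambda>(x, y). Complex x y)"
proof (rule lborel_eqI)
  show "sets (distr (lborel \<Otimes>\<^sub>M lborel) borel (\<lambda>(x, y). Complex x y)) = sets borel"
    by simp
next
  fix l u :: complex
  assume le: "\<And>b. b \<in> Basis \<Longrightarrow> l \<bullet> b \<le> u \<bullet> b"
  have le': "Re l \<le> Re u" "Im l \<le> Im u"
    using le[of 1] le[of \<i>] by (auto simp: Basis_complex_def)
  have vim: "(\<lambda>(x, y). Complex x y) -` box l u \<inter> space (lborel \<Otimes>\<^sub>M lborel)
      = {Re l<..<Re u} \<times> {Im l<..<Im u}"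
    by (auto simp: box_def Basis_complex_def space_pair_measure)
  have "emeasure (distr (lborel \<Otimes>\<^sub>M lborel) borel (\<lambda>(x, y). Complex x y)) (box l u)
      = emeasure (lborel \<Otimes>\<^sub>M lborel) ({Re l<..<Re u} \<times> {Im l<..<Im u})"
    by (subst emeasure_distr) (auto simp: vim)
  also have "\<dots> = ennreal (Re u - Re l) * ennreal (Im u - Im l)"
    using le' by (subst lborel.emeasure_pair_measure_Times) auto
  also have "\<dots> = ennreal (\<Prod>b\<in>Basis. (u - l) \<bullet> b)"
    using le' by (simp add: Basis_complex_def ennreal_mult)
  finally show "emeasure (distr (lborel \<Otimes>\<^sub>M lborel) borel (\<lambda>(x, y). Complex x y)) (box l u)
      = (\<Prod>b\<in>Basis. (u - l) \<bullet> b)" .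
qed

text \<open>Tonelli in both orders: a horizontal shear needs the inner integral over the real part,
  a vertical shear over the imaginary part.\<close>

lemma nn_integral_lborel_complex:
  fixes g :: "complex \<Rightarrow> ennreal"
  assumes [measurable]: "g \<in> borel_measurable borel"
  shows "(\<integral>\<^sup>+ z. g z \<partial>lborel) = (\<integral>\<^sup>+ y. \<integral>\<^sup>+ x. g (Complex x y) \<partial>lborel \<partial>lborel)" (is ?A)
    and "(\<integral>\<^sup>+ z. g z \<partial>lborel) = (\<integral>\<^sup>+ x. \<integral>\<^sup>+ y. g (Complex x y) \<partial>lborel \<partial>lborel)" (is ?B)
proof -
  have m: "(\<lambda>w. g (case w of (x, y) \<Rightarrow> Complex x y)) \<in> borel_measurable (lborel \<Otimes>\<^sub>M lborel)"
    using measurable_compose[OF borel_measurable_Complex assms] by simp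
  have "(\<integral>\<^sup>+ z. g z \<partial>lborel) =
      (\<integral>\<^sup>+ w. g (case w of (x, y) \<Rightarrow> Complex x y) \<partial>(lborel \<Otimes>\<^sub>M lborel))"
    by (subst lborel_complex_eq_distr, subst nn_integral_distr) auto
  then show ?A ?B
    using lborel_pair.nn_integral_snd[OF m] lborel.nn_integral_fst[OF m] by auto
qed

section \<open>Invariance under shears and rotations\<close>

lemma nn_integral_shear_Re:
  fixes g :: "complex \<Rightarrow> ennreal"
  assumes [measurable]: "g \<in> borel_measurable borel"
  shows "(\<integral>\<^sup>+ z. g (z + of_real (a * Im z)) \<partial>lborel) = (\<integral>\<^sup>+ z. g z \<partial>lborel)"
proof -
  \<comment> \<open>On each horizontal line the shear is a translation by the constant
    \<open>a * y\<close>.\<close>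
  have *: "(\<integral>\<^sup>+ x. g (Complex (x + a * y) y) \<partial>lborel) = (\<integral>\<^sup>+ x. g (Complex x y) \<partial>lborel)" for y
    using nn_integral_real_affine[of "\<lambda>x. g (Complex x y)" 1 "a * y"]
    by (simp add: Complex_eq add.commute)
  have "(\<integral>\<^sup>+ z. g (z + of_real (a * Im z)) \<partial>lborel)
      = (\<integral>\<^sup>+ y. \<integral>\<^sup>+ x. g (Complex x y + of_real (a * y)) \<partial>lborel \<partial>lborel)"
    by (subst nn_integral_lborel_complex(1)) auto
  also have "\<dots> = (\<integral>\<^sup>+ y. \<integral>\<^sup>+ x. g (Complex (x + a * y) y) \<partial>lborel \<partial>lborel)"
    by (simp add: complex_add complex_of_real_def)
  also have "\<dots> = (\<integral>\<^sup>+ z. g z \<partial>lborel)"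
    by (simp add: * nn_integral_lborel_complex(1))
  finally show ?thesis .
qed

lemma nn_integral_shear_Im:
  fixes g :: "complex \<Rightarrow> ennreal"
  assumes [measurable]: "g \<in> borel_measurable borel"
  shows "(\<integral>\<^sup>+ z. g (z + \<i> * of_real (a * Re z)) \<partial>lborel) = (\<integral>\<^sup>+ z. g z \<partial>lborel)"
proof -
  have *: "(\<integral>\<^sup>+ y. g (Complex x (y + a * x)) \<partial>lborel) = (\<integral>\<^sup>+ y. g (Complex x y) \<partial>lborel)" for x
    using nn_integral_real_affine[of "\<lambda>y. g (Complex x y)" 1 "a * x"]
    by (simp add: Complex_eq add.commute)
  have "(\<integral>\<^sup>+ z. g (z + \<i> * of_real (a * Re z)) \<partial>lborel)
      = (\<integral>\<^sup>+ x. \<integral>\<^sup>+ y. g (Complex x y + \<i> * of_real (a * x)) \<partial>lborel \<partial>lborel)"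
    by (subst nn_integral_lborel_complex(2)) auto
  also have "\<dots> = (\<integral>\<^sup>+ x. \<integral>\<^sup>+ y. g (Complex x (y + a * x)) \<partial>lborel \<partial>lborel)"
    by (intro nn_integral_cong arg_cong[where f = g]) (simp add: complex_eq_iff)
  also have "\<dots> = (\<integral>\<^sup>+ z. g z \<partial>lborel)"
    by (simp add: * nn_integral_lborel_complex(2))
  finally show ?thesis .
qed

text \<open>A rotation by an angle outside \<open>\<pi>\<int>\<close> is a product of three shears, and \<open>-1 = \<i>\<^sup>2\<close>.\<close>

lemma nn_integral_lborel_rotate:
  fixes g :: "complex \<Rightarrow> ennreal"
  assumes [measurable]: "g \<in> borel_measurable borel" and u: "norm u = 1"
  shows "(\<integral>\<^sup>+ z. g (u * z) \<partial>lborel) = (\<integral>\<^sup>+ z. g z \<partial>lborel)"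
proof -
  have shears: "(\<integral>\<^sup>+ z. g (v * z) \<partial>lborel) = (\<integral>\<^sup>+ z. g z \<partial>lborel)"
    if v: "norm v = 1" "Im v \<noteq> 0" and [measurable]: "g \<in> borel_measurable borel"
    for v and g :: "complex \<Rightarrow> ennreal"
  proof -
    \<comment> \<open>For \<open>v = cis t\<close> this is \<open>- tan (t / 2)\<close>; requiring
      \<open>X\<close>, \<open>Y\<close>, \<open>X\<close> to compose to multiplication by
      \<open>v\<close> forces it.\<close>
    define a where "a = (Re v - 1) / Im v"
    define X where "X z = z + of_real (a * Im z)" for z
    define Y where "Y z = z + \<i> * of_real (Im v * Re z)" for z
    have [measurable]: "X \<in> borel_measurable borel" "Y \<in> borel_measurable borel"
      unfolding X_def Y_def by measurable
    have gXY: "(\<lambda>z. g (X (Y z))) \<in> borel_measurable borel"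
      and gX: "(\<lambda>z. g (X z)) \<in> borel_measurable borel"
      by measurable
    have a: "a * Im v = Re v - 1"
      using v by (simp add: a_def)
    have sq: "(Re v)\<^sup>2 + (Im v)\<^sup>2 = 1"
      using v by (metis cmod_power2 one_power2)
    \<comment> \<open>The upper right entry of the product of the three shear matrices is
      \<open>a * (2 + a * Im v)\<close>, that is \<open>a * (Re v + 1)\<close>; in the rotation
      matrix it is \<open>- Im v\<close>.\<close>
    have "(a * (Re v + 1) + Im v) * Im v = 0"
      using a sq by algebra
    then have a': "a * (Re v + 1) = - Im v"
      using v by simp
    have "X (Y (X z)) = v * z" for z
    proof (rule complex_eqI)
      show "Re (X (Y (X z))) = Re (v * z)"
        using a a' by (simp add: X_def Y_def) algebra
      show "Im (X (Y (X z))) = Im (v * z)"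
        using a by (simp add: X_def Y_def) algebra
    qed
    then have "(\<integral>\<^sup>+ z. g (v * z) \<partial>lborel) = (\<integral>\<^sup>+ z. g (X (Y (X z))) \<partial>lborel)"
      by simp
    also have "\<dots> = (\<integral>\<^sup>+ z. g (X (Y z)) \<partial>lborel)"
      using nn_integral_shear_Re[OF gXY, of a] by (simp only: X_def)
    also have "\<dots> = (\<integral>\<^sup>+ z. g (X z) \<partial>lborel)"
      using nn_integral_shear_Im[OF gX, of "Im v"] by (simp only: Y_def)
    also have "\<dots> = (\<integral>\<^sup>+ z. g z \<partial>lborel)"
      using nn_integral_shear_Re[OF that(3), of a] by (simp only: X_def)
    finally show ?thesis .
  qed
  show ?thesis
  proof (cases "Im u = 0")
    case False
    then show ?thesis using shears u by simp
  next
    case True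
    then have "u = 1 \<or> u = -1"
      using u by (auto simp: complex_eq_iff cmod_def)
    then show ?thesis
    proof
      assume "u = -1"
      have "(\<integral>\<^sup>+ z. g (u * z) \<partial>lborel) = (\<integral>\<^sup>+ z. g (\<i> * (\<i> * z)) \<partial>lborel)"
        using \<open>u = -1\<close> by (simp add: mult.assoc[symmetric])
      also have "\<dots> = (\<integral>\<^sup>+ z. g z \<partial>lborel)"
        using shears[of \<i> "\<lambda>z. g (\<i> * z)"] shears[of \<i> g] by simp
      finally show ?thesis .
    qed simp
  qed
qed

text \<open>After the integrals are swapped, rotation invariance makes the inner one independent of
  \<open>t\<close>, and \<open>t\<close> runs over an interval of length 1. This takes the place of
  polar coordinates.\<close>

lemma nn_integral_lborel_circle_mean:
  fixes g :: "complex \<Rightarrow> ennreal"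
  assumes [measurable]: "g \<in> borel_measurable borel"
  shows "(\<integral>\<^sup>+ z. \<integral>\<^sup>+ t. g (z * cis (2 * pi * t)) * indicator {0..1} t \<partial>lborel \<partial>lborel)
       = (\<integral>\<^sup>+ z. g z \<partial>lborel)"
    and "(\<lambda>z. \<integral>\<^sup>+ t. g (z * cis (2 * pi * t)) * indicator {0..1} t \<partial>lborel) \<in> borel_measurable lborel"
proof -
  have "(\<lambda>w::complex \<times> real. fst w * cis (2 * pi * snd w)) \<in> borel_measurable borel"
    by (intro borel_measurable_continuous_onI continuous_intros)
  then have [measurable]: "(\<lambda>w. fst w * cis (2 * pi * snd w))
      \<in> borel_measurable ((lborel :: complex measure) \<Otimes>\<^sub>M lborel)"
    by (simp add: lborel_prod)
  have m: "(\<lambda>w. g (fst w * cis (2 * pi * snd w)) * indicator {0..1} (snd w))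
      \<in> borel_measurable ((lborel :: complex measure) \<Otimes>\<^sub>M lborel)"
    by measurable
  show "(\<lambda>z. \<integral>\<^sup>+ t. g (z * cis (2 * pi * t)) * indicator {0..1} t \<partial>lborel) \<in> borel_measurable lborel"
    using lborel.borel_measurable_nn_integral_fst[OF m] by simp
  have rot: "(\<integral>\<^sup>+ z. g (z * cis (2 * pi * t)) \<partial>lborel) = (\<integral>\<^sup>+ z. g z \<partial>lborel)" for t
    using nn_integral_lborel_rotate[of g "cis (2 * pi * t)"] by (simp add: mult.commute)
  have "(\<integral>\<^sup>+ z. \<integral>\<^sup>+ t. g (z * cis (2 * pi * t)) * indicator {0..1} t \<partial>lborel \<partial>lborel)
      = (\<integral>\<^sup>+ t. \<integral>\<^sup>+ z. g (z * cis (2 * pi * t)) * indicator {0..1} t \<partial>lborel \<partial>lborel)"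
    using lborel_pair.Fubini[OF m] by simp
  also have "\<dots> = (\<integral>\<^sup>+ t. (\<integral>\<^sup>+ z. g z \<partial>lborel) * indicator {0..1} (t::real) \<partial>lborel)"
    by (subst nn_integral_multc) (auto simp: rot)
  also have "\<dots> = (\<integral>\<^sup>+ z. g z \<partial>lborel)"
    by (simp add: nn_integral_cmult)
  finally show "(\<integral>\<^sup>+ z. \<integral>\<^sup>+ t. g (z * cis (2 * pi * t)) * indicator {0..1} t \<partial>lborel \<partial>lborel)
       = (\<integral>\<^sup>+ z. g z \<partial>lborel)" .
qed

section \<open>Radial Gaussian integrals\<close>

lemma distr_norm_sq_complex:
  "distr lborel borel (\<lambda>z::complex. (norm z)\<^sup>2) = density lborel (\<lambda>s. ennreal pi * indicator {0..} s)"
proof (rule measure_eqI_generator_eq[where E = "range atMost" and \<Omega> = UNIV and A = "\<lambda>i. {..real i}"])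
  show "Int_stable (range (atMost :: real \<Rightarrow> _))"
    by (auto simp: Int_stable_def)
  \<comment> \<open>The preimage of \<open>{..a}\<close> is empty or the closed disc of radius
    \<open>sqrt a\<close>, whose area is linear in \<open>a\<close>; this is why the image measure
    has constant density.\<close>
  have eq: "emeasure (distr lborel borel (\<lambda>z::complex. (norm z)\<^sup>2)) {..a} =
     (if a < 0 then 0 else ennreal (pi * a))" for a
  proof (cases "a < 0")
    case True
    then have "\<not> (norm z)\<^sup>2 \<le> a" for z :: complex
      using zero_le_power2[of "norm z"] by linarith
    then have "(\<lambda>z::complex. (norm z)\<^sup>2) -` {..a} = {}"
      by auto
    with True show ?thesis
      by (subst emeasure_distr) auto
  next
    case False
    then have "(\<lambda>z::complex. (norm z)\<^sup>2) -` {..a} = cball 0 (sqrt a)"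
      by (auto simp: real_le_rsqrt sqrt_ge_absD)
    with False show ?thesis
      by (subst emeasure_distr) (auto simp: emeasure_cball unit_ball_vol_2)
  qed
  have eq': "emeasure (density lborel (\<lambda>s. ennreal pi * indicator {0..} s)) {..a} =
     (if a < 0 then 0 else ennreal (pi * a))" for a
  proof -
    have "emeasure (density lborel (\<lambda>s. ennreal pi * indicator {0..} s)) {..a}
        = (\<integral>\<^sup>+ s. ennreal pi * indicator {0..a} s \<partial>lborel)"
      by (subst emeasure_density) (auto intro!: nn_integral_cong split: split_indicator)
    also have "\<dots> = ennreal pi * emeasure lborel {0..a}"
      by (subst nn_integral_cmult) auto
    finally show ?thesis
      by (auto simp: ennreal_mult)
  qed
  show "emeasure (distr lborel borel (\<lambda>z::complex. (norm z)\<^sup>2)) X =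
    emeasure (density lborel (\<lambda>s. ennreal pi * indicator {0..} s)) X" if "X \<in> range atMost" for X
    using that eq eq' by auto
  show "emeasure (distr lborel borel (\<lambda>z::complex. (norm z)\<^sup>2)) {..real i} \<noteq> \<infinity>" for i
    by (simp add: eq)
  show "(\<Union>i. {..real i}) = UNIV"
    by (auto simp: real_arch_simple)
qed (auto simp: borel_eq_atMost)

lemma nn_integral_powr_gaussian:
  assumes q: "q \<ge> 0" and b: "b > 0"
  shows "(\<integral>\<^sup>+ z. ennreal (norm (z::complex) powr q * exp (- (b * (norm z)\<^sup>2))) \<partial>lborel)
       = ennreal (pi * Gamma (1 + q / 2) / b powr (1 + q / 2))"
proof -
  define F where "F = (\<lambda>s. ennreal (s powr (q / 2) * exp (- (b * s))) * indicator {0..} s)"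
  have [measurable]: "F \<in> borel_measurable borel"
    unfolding F_def by measurable
  \<comment> \<open>This includes \<open>z = 0\<close> with \<open>q = 0\<close>, since
    \<open>0 powr 0 = 0\<close> on both sides.\<close>
  have "norm z powr q = (norm z)\<^sup>2 powr (q / 2)" for z :: complex
    by (cases "z = 0") (auto simp: powr_powr simp flip: powr_numeral)
  then have "(\<integral>\<^sup>+ z. ennreal (norm (z::complex) powr q * exp (- (b * (norm z)\<^sup>2))) \<partial>lborel)
      = (\<integral>\<^sup>+ z. F ((norm (z::complex))\<^sup>2) \<partial>lborel)"
    by (simp add: F_def)
  also have "\<dots> = (\<integral>\<^sup>+ s. F s \<partial>(distr lborel borel (\<lambda>z::complex. (norm z)\<^sup>2)))"
    by (subst nn_integral_distr) auto
  also have "\<dots> = (\<integral>\<^sup>+ s. ennreal pi * F s \<partial>lborel)"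
    unfolding distr_norm_sq_complex
    by (subst nn_integral_density)
       (auto intro!: nn_integral_cong simp: F_def split: split_indicator)
  also have "\<dots> = ennreal pi * (\<integral>\<^sup>+ s. F s \<partial>lborel)"
    by (simp add: nn_integral_cmult)
  \<comment> \<open>The substitution \<open>t = b * s\<close> brings the integrand to the standard
    Gamma form.\<close>
  also have "(\<integral>\<^sup>+ s. F s \<partial>lborel) = ennreal (1 / b) * (\<integral>\<^sup>+ t. F (t / b) \<partial>lborel)"
    using b nn_integral_real_affine[of F "1 / b" 0] by simp
  also have "(\<integral>\<^sup>+ t. F (t / b) \<partial>lborel)
      = (\<integral>\<^sup>+ t. ennreal (b powr (- (q / 2))) *
           (ennreal (t powr (1 + q / 2 - 1) / exp t) * indicator {0..} t) \<partial>lborel)"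
    using b by (intro nn_integral_cong)
      (auto simp: F_def ennreal_mult[symmetric] powr_divide powr_minus exp_minus field_simps
        split: split_indicator)
  also have "\<dots> = ennreal (b powr (- (q / 2))) *
      (\<integral>\<^sup>+ t. ennreal (t powr (1 + q / 2 - 1) / exp t) * indicator {0..} t \<partial>lborel)"
    by (rule nn_integral_cmult) auto
  also have "(\<integral>\<^sup>+ t. ennreal (t powr (1 + q / 2 - 1) / exp t) * indicator {0..} t \<partial>lborel)
      = ennreal (Gamma (1 + q / 2))"
    using q by (intro nn_integral_has_integral_lebesgue' Gamma_integral_real) auto
  also have "ennreal pi * (ennreal (1 / b) * (ennreal (b powr (- (q / 2))) * ennreal (Gamma (1 + q / 2))))
      = ennreal (pi * Gamma (1 + q / 2) / b powr (1 + q / 2))"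
  proof -
    have "b powr (1 + q / 2) = b * b powr (q / 2)"
      using b by (simp add: powr_add)
    then have "pi * (1 / b * (b powr (- (q / 2)) * Gamma (1 + q / 2)))
        = pi * Gamma (1 + q / 2) / b powr (1 + q / 2)"
      using b by (simp add: powr_minus_divide)
    moreover have "0 < Gamma (1 + q / 2)"
      using q by (intro Gamma_real_pos) auto
    ultimately show ?thesis
      using b by (metis ennreal_mult'' less_imp_le mult_nonneg_nonneg pi_ge_zero powr_ge_zero
          zero_le_divide_1_iff)
  qed
  finally show ?thesis .
qed

section \<open>Circular means of entire functions\<close>

lemma higher_deriv_circle_mean:
  assumes f: "f holomorphic_on UNIV"
  shows "((\<lambda>t. f (z * cis (2 * pi * t)) * cis (- (2 * pi * real n * t)))
           has_integral (deriv ^^ n) f 0 / fact n * z ^ n) {0..1}"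
proof -
  \<comment> \<open>Moving \<open>z\<close> into the function lets Cauchy's formula be used on the
    unit circle for every \<open>z\<close>, including \<open>z = 0\<close>.\<close>
  define g where "g = (\<lambda>w. f (z * w))"
  have g: "g holomorphic_on UNIV"
    unfolding g_def by (intro holomorphic_on_compose_gen[OF _ f, unfolded o_def] holomorphic_intros) auto
  have d: "(deriv ^^ n) g 0 = z ^ n * (deriv ^^ n) f 0"
    unfolding g_def using higher_deriv_compose_linear[OF f, of UNIV 0 z n] by simp
  have "((\<lambda>u. g u / (u - 0) ^ Suc n) has_contour_integral
      (2 * pi * \<i>) / fact n * (deriv ^^ n) g 0) (circlepath 0 1)"
    using g by (intro Cauchy_has_contour_integral_higher_derivative_circlepath)
      (auto intro: holomorphic_on_imp_continuous_on holomorphic_on_subset)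
  then have "((\<lambda>t. g (cis (2 * pi * t)) / cis (2 * pi * t) ^ Suc n *
       (2 * pi * \<i> * cis (2 * pi * t))) has_integral
       (2 * pi * \<i>) / fact n * (deriv ^^ n) g 0) {0..1}"
    unfolding has_contour_integral_def
    by (rule has_integral_eq[rotated])
       (simp add: vector_derivative_circlepath01, simp add: circlepath cis_conv_exp mult_ac)
  then have "((\<lambda>t. 1 / (2 * pi * \<i>) * (g (cis (2 * pi * t)) / cis (2 * pi * t) ^ Suc n *
       (2 * pi * \<i> * cis (2 * pi * t)))) has_integral
       1 / (2 * pi * \<i>) * ((2 * pi * \<i>) / fact n * (deriv ^^ n) g 0)) {0..1}"
    by (rule has_integral_mult_right)
  also have "1 / (2 * pi * \<i>) * ((2 * pi * \<i>) / fact n * (deriv ^^ n) g 0)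
      = (deriv ^^ n) f 0 / fact n * z ^ n"
    by (simp add: d)
  also have "(\<lambda>t. 1 / (2 * pi * \<i>) * (g (cis (2 * pi * t)) / cis (2 * pi * t) ^ Suc n *
       (2 * pi * \<i> * cis (2 * pi * t))))
     = (\<lambda>t. f (z * cis (2 * pi * t)) * cis (- (2 * pi * real n * t)))"
  proof
    fix t :: real
    \<comment> \<open>The derivative of the circle path cancels one of the \<open>Suc n\<close>
      powers in the Cauchy kernel.\<close>
    have "1 / (2 * pi * \<i>) * (g (cis (2 * pi * t)) / cis (2 * pi * t) ^ Suc n *
       (2 * pi * \<i> * cis (2 * pi * t))) = g (cis (2 * pi * t)) / cis (2 * pi * t) ^ n"
      by (simp add: field_simps)
    also have "\<dots> = g (cis (2 * pi * t)) * cis (- (2 * pi * real n * t))"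
      by (simp add: Complex.DeMoivre divide_inverse cis_inverse mult_ac flip: power_inverse)
    finally show "1 / (2 * pi * \<i>) * (g (cis (2 * pi * t)) / cis (2 * pi * t) ^ Suc n *
       (2 * pi * \<i> * cis (2 * pi * t))) = f (z * cis (2 * pi * t)) * cis (- (2 * pi * real n * t))"
      by (simp add: g_def)
  qed
  finally show ?thesis .
qed

text \<open>Young's inequality with weights \<open>1 / p\<close> and \<open>1 - 1 / p\<close>,
  applied to \<open>x powr p\<close> and \<open>1\<close>.\<close>

lemma powr_ge_tangent:
  fixes x p :: real
  assumes "x \<ge> 0" "p \<ge> 1"
  shows "1 + p * (x - 1) \<le> x powr p"
proof (cases "x = 0")
  case False
  have "(x powr p) powr (1 / p) * 1 powr (1 - 1 / p) \<le> 1 / p * x powr p + (1 - 1 / p) * 1"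
    using assms False by (intro Youngs_inequality_0) auto
  then have "x \<le> 1 / p * x powr p + (1 - 1 / p)"
    using assms by (simp add: powr_powr)
  then have "p * x \<le> p * (1 / p * x powr p + (1 - 1 / p))"
    using assms by (intro mult_left_mono) auto
  then show ?thesis
    using assms by (simp add: algebra_simps)
qed (use assms in auto)

text \<open>
  The tangent plane at \<open>1\<close> of the convex function \<open>|w|\<^sup>p\<close>. For \<open>p = 1\<close> it touches the graph along
  the whole positive axis, so reality of \<open>w\<close> is all that equality gives for every \<open>p\<close>.
\<close>

lemma norm_powr_ge_tangent:
  fixes w :: complex
  assumes "p \<ge> 1"
  shows "1 + p * (Re w - 1) \<le> norm w powr p"
    and "norm w powr p = 1 + p * (Re w - 1) \<Longrightarrow> Im w = 0"
proof -
  have 1: "1 + p * (norm w - 1) \<le> norm w powr p"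
    using assms by (intro powr_ge_tangent) auto
  have 2: "p * (Re w - 1) \<le> p * (norm w - 1)"
    using assms complex_Re_le_cmod[of w] by (intro mult_left_mono) auto
  from 1 2 show "1 + p * (Re w - 1) \<le> norm w powr p"
    by linarith
  assume "norm w powr p = 1 + p * (Re w - 1)"
  with 1 2 have "p * (norm w - 1) = p * (Re w - 1)"
    by linarith
  then have "norm w = Re w"
    using assms by simp
  then have "(Re w)\<^sup>2 + (Im w)\<^sup>2 = (Re w)\<^sup>2"
    by (metis cmod_power2)
  then show "Im w = 0"
    by simp
qed

text \<open>The tangent plane bound, averaged over the circle through \<open>z\<close>. The equality
  case is stated with \<open>cnj c\<close> instead of a quotient by \<open>c\<close>, so it also
  covers \<open>c = 0\<close> and is a closed condition on \<open>z\<close>.\<close>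

lemma circle_mean_powr_ge:
  fixes f :: "complex \<Rightarrow> complex"
  assumes f: "f holomorphic_on UNIV" and p: "p \<ge> 1"
    and c: "c = (deriv ^^ n) f 0 / fact n * z ^ n"
  shows "norm c powr p \<le> integral {0..1} (\<lambda>t. norm (f (z * cis (2 * pi * t))) powr p)"
    and "norm c powr p = integral {0..1} (\<lambda>t. norm (f (z * cis (2 * pi * t))) powr p)
           \<Longrightarrow> Im (f z * cnj c) = 0"
proof -
  have cf: "continuous_on UNIV f"
    using f by (rule holomorphic_on_imp_continuous_on)
  have cont: "continuous_on {0..1} (\<lambda>t. f (z * cis (2 * pi * t)))"
    by (intro continuous_on_compose2[OF cf] continuous_intros) auto
  have contp: "continuous_on {0..1} (\<lambda>t. norm (f (z * cis (2 * pi * t))) powr p)"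
    using p by (intro continuous_on_powr' continuous_intros cont) auto
  have "norm c powr p \<le> integral {0..1} (\<lambda>t. norm (f (z * cis (2 * pi * t))) powr p) \<and>
    (norm c powr p = integral {0..1} (\<lambda>t. norm (f (z * cis (2 * pi * t))) powr p)
           \<longrightarrow> Im (f z * cnj c) = 0)"
  proof (cases "c = 0")
    case True
    then show ?thesis
      using p by (auto intro!: integral_nonneg integrable_continuous_real contp)
  next
    case False
    \<comment> \<open>\<open>h\<close> is normalized to have mean 1, so the tangent plane at 1 has
      mean 1 as well. \<open>T\<close> is that plane rescaled by \<open>norm c powr p\<close>, and
      \<open>D\<close> is the nonnegative gap above it.\<close>
    define h where "h = (\<lambda>t. f (z * cis (2 * pi * t)) * cis (- (2 * pi * real n * t)) / c)"
    define T where "T = (\<lambda>t. norm c powr p * (1 + p * (Re (h t) - 1)))"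
    define D where "D = (\<lambda>t. norm (f (z * cis (2 * pi * t))) powr p - T t)"
    have "(h has_integral c / c) {0..1}"
      unfolding h_def by (rule has_integral_divide, unfold c, rule higher_deriv_circle_mean[OF f])
    then have "((\<lambda>t. Re (h t)) has_integral 1) {0..1}"
      using has_integral_Re[of h "c / c"] False by simp
    moreover have "((\<lambda>t::real. 1::real) has_integral 1) {0..1}"
      using has_integral_const_real[of "1::real" 0 1] by simp
    ultimately have "(T has_integral norm c powr p * (1 + p * (1 - 1))) {0..1}"
      unfolding T_def
      by (intro has_integral_mult_right has_integral_add has_integral_diff)
    then have T: "(T has_integral norm c powr p) {0..1}"
      by simp
    have D: "(D has_integral integral {0..1} (\<lambda>t. norm (f (z * cis (2 * pi * t))) powr p)
        - norm c powr p) {0..1}"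
      unfolding D_def
      by (intro has_integral_diff T integrable_integral integrable_continuous_real contp)
    have nh: "norm (h t) = norm (f (z * cis (2 * pi * t))) / norm c" for t
      by (simp add: h_def norm_mult norm_divide)
    have eq: "norm (f (z * cis (2 * pi * t))) powr p = norm c powr p * norm (h t) powr p" for t
      unfolding nh using False by (simp add: powr_divide)
    have D_alt: "D t = norm c powr p * (norm (h t) powr p - (1 + p * (Re (h t) - 1)))" for t
      unfolding D_def T_def eq by (simp add: algebra_simps)
    have D0: "D t \<ge> 0" for t
      unfolding D_alt using norm_powr_ge_tangent(1)[OF p, of "h t"] by simp
    have contD: "continuous_on {0..1} D"
      unfolding D_def T_def h_def by (intro continuous_intros contp cont) (use False in auto)
    have "norm c powr p \<le> integral {0..1} (\<lambda>t. norm (f (z * cis (2 * pi * t))) powr p)"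
      using has_integral_nonneg[OF D] D0 by simp
    moreover have "Im (f z * cnj c) = 0"
      if "norm c powr p = integral {0..1} (\<lambda>t. norm (f (z * cis (2 * pi * t))) powr p)"
    proof -
      have "integral {0..1} D = 0"
        using D that by (simp add: integral_unique)
      \<comment> \<open>A continuous nonnegative function with integral 0 vanishes everywhere;
        \<open>t = 0\<close> is the point \<open>z\<close> itself.\<close>
      then have "D 0 = 0"
        using integral_eq_0_iff[OF contD] D0 by auto
      then have "Im (h 0) = 0"
        using False unfolding D_alt by (intro norm_powr_ge_tangent(2)[OF p]) auto
      then show ?thesis
        by (simp add: h_def Im_complex_div_eq_0)
    qed
    ultimately show ?thesis
      by blast
  qed
  then show "norm c powr p \<le> integral {0..1} (\<lambda>t. norm (f (z * cis (2 * pi * t))) powr p)"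
    and "norm c powr p = integral {0..1} (\<lambda>t. norm (f (z * cis (2 * pi * t))) powr p)
           \<Longrightarrow> Im (f z * cnj c) = 0"
    by auto
qed

section \<open>Rigidity in the equality case\<close>

lemma entire_real_multiple_of_monomial:
  assumes f: "f holomorphic_on UNIV" and a: "a \<noteq> 0" and n: "n \<ge> 1"
    and im: "\<And>z. Im (f z * cnj (a * z ^ n)) = 0"
  shows "\<exists>A. f = (\<lambda>w. A * w ^ n)"
proof -
  define h where "h = (\<lambda>z. f z / (a * z ^ n))"
  have hol: "h holomorphic_on - {0}"
    unfolding h_def using a by (intro holomorphic_intros holomorphic_on_subset[OF f]) auto
  have con: "connected (- {0 :: complex})"
    by (simp add: connected_punctured_universe)
  have imh: "Im (h z) = 0" if "z \<noteq> 0" for z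
    unfolding h_def Im_complex_div_eq_0 by (rule im)
  have "h constant_on - {0}"
  proof (rule ccontr)
    assume "\<not> h constant_on - {0}"
    then have op: "open (h ` (- {0}))"
      using open_mapping_thm[OF hol, of "- {0}"] con by auto
    have "h 1 \<in> h ` (- {0})"
      by auto
    then obtain e where e: "e > 0" "ball (h 1) e \<subseteq> h ` (- {0})"
      using op open_contains_ball by blast
    \<comment> \<open>A point straight above the real number \<open>h 1\<close> is not real, yet an
      open image would contain it.\<close>
    have "h 1 + \<i> * of_real (e / 2) \<in> ball (h 1) e"
      using e by (simp add: dist_norm norm_mult)
    with e(2) have "h 1 + \<i> * of_real (e / 2) \<in> h ` (- {0})"
      by (rule subsetD)
    then obtain z where "z \<noteq> 0" "h 1 + \<i> * of_real (e / 2) = h z"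
      by blast
    then have "Im (h 1 + \<i> * of_real (e / 2)) = 0"
      using imh by simp
    then show False
      using imh[of 1] e by simp
  qed
  then obtain k where k: "\<And>z. z \<noteq> 0 \<Longrightarrow> h z = k"
    by (auto simp: constant_on_def)
  have off: "f z = k * a * z ^ n" if "z \<noteq> 0" for z
    using k[OF that] that a by (simp add: h_def field_simps)
  \<comment> \<open>At \<open>0\<close> the quotient \<open>h\<close> is a division by zero and
    carries no information, so \<open>f 0\<close> is recovered by continuity.\<close>
  have cf: "isCont f 0"
    using holomorphic_on_imp_continuous_on[OF f] by (simp add: continuous_on_eq_continuous_at)
  have "(f \<longlongrightarrow> f 0) (at 0)"
    using cf by (simp add: isCont_def)
  moreover have "((\<lambda>z. k * a * z ^ n) \<longlongrightarrow> k * a * 0 ^ n) (at 0)"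
    by (intro tendsto_intros)
  then have "(f \<longlongrightarrow> k * a * 0 ^ n) (at 0)"
    by (rule Lim_transform_eventually) (auto simp: eventually_at_filter off)
  ultimately have "f 0 = k * a * 0 ^ n"
    using tendsto_unique by (metis at_neq_bot)
  with off have "f = (\<lambda>w. k * a * w ^ n)"
    by (metis (full_types))
  then show ?thesis
    by blast
qed

text \<open>Finiteness makes the integral of \<open>v - u\<close> the difference of the integrals,
  which is 0, so the nonnegative function \<open>v - u\<close> vanishes almost everywhere.\<close>

lemma AE_eq_if_nn_integral_eq:
  fixes u v :: "'a \<Rightarrow> ennreal"
  assumes [measurable]: "u \<in> borel_measurable M" "v \<in> borel_measurable M"
    and le: "\<And>x. u x \<le> v x" and eq: "integral\<^sup>N M u = integral\<^sup>N M v"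
    and fin: "integral\<^sup>N M u \<noteq> \<infinity>"
  shows "AE x in M. u x = v x"
proof -
  have "(\<integral>\<^sup>+ x. v x - u x \<partial>M) = integral\<^sup>N M v - integral\<^sup>N M u"
    using fin le by (intro nn_integral_diff) auto
  also have "\<dots> = 0"
    using eq fin by simp
  finally have "AE x in M. v x - u x = 0"
    by (subst (asm) nn_integral_0_iff_AE) auto
  moreover have "AE x in M. u x \<noteq> \<infinity>"
    using fin by (intro nn_integral_PInf_AE) auto
  ultimately show ?thesis
  proof eventually_elim
    case (elim x)
    then have "v x \<le> u x"
      by (simp add: diff_eq_0_iff_ennreal)
    then show ?case
      using le[of x] by simp
  qed
qed

section \<open>Fock norms of monomials and of Taylor terms\<close>

lemma higher_deriv_monomial_0: "(deriv ^^ n) (\<lambda>w. A * w ^ n) 0 = (A::complex) * fact n"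
proof -
  have "(deriv ^^ n) (\<lambda>w. A * w ^ n) 0 = A * (deriv ^^ n) (\<lambda>w. w ^ n) (0::complex)"
    by (rule higher_deriv_cmult[of _ UNIV]) (auto intro: holomorphic_intros)
  also have "(deriv ^^ n) (\<lambda>w. w ^ n) (0::complex) = fact n"
    using higher_deriv_power[of n 0 n "0::complex"] by (simp add: pochhammer_fact)
  finally show ?thesis .
qed

text \<open>Completing a measure does not change nonnegative integrals; the invariance results above
  are about \<open>lborel\<close>.\<close>

lemma fock_norm_pow_lborel:
  "fock_norm_pow \<alpha> p f = ennreal (p * \<alpha> / (2 * pi)) *
     (\<integral>\<^sup>+ z. ennreal (norm (f z) powr p * exp (- (p * \<alpha> / 2 * (norm z)\<^sup>2))) \<partial>lborel)"
  unfolding fock_norm_pow_def nn_integral_completion by simp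

text \<open>The Gaussian integral with \<open>q = n * p\<close> and
  \<open>b = p * \<alpha> / 2\<close>. The prefactor of the norm equals \<open>b / pi\<close>, which
  removes \<open>pi\<close> and one power of \<open>b\<close>.\<close>

lemma fock_norm_pow_monomial:
  assumes \<alpha>: "\<alpha> > 0" and p: "p > 0"
  shows "fock_norm_pow \<alpha> p (\<lambda>w. A * w ^ n)
       = ennreal (norm A powr p * (Gamma (1 + real n * p / 2) / (\<alpha> * p / 2) powr (real n * p / 2)))"
proof -
  define b where "b = p * \<alpha> / 2"
  have b: "b > 0"
    using \<alpha> p by (simp add: b_def)
  have "0 < Gamma (1 + real n * p / 2)"
    using p by (intro Gamma_real_pos) (auto simp: add_pos_nonneg)
  then have K: "0 \<le> pi * Gamma (1 + real n * p / 2) / b powr (1 + real n * p / 2)"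
    by simp
  \<comment> \<open>For \<open>n = 0\<close> the two sides differ at the origin when
    \<open>A\<close> is nonzero, because \<open>0 powr 0 = 0\<close>; a single point is a null
    set.\<close>
  have pw: "norm (A * z ^ n) powr p = norm A powr p * norm z powr (real n * p)"
    if "z \<noteq> 0" for z :: complex
    using that powr_realpow[of "norm z" n, symmetric]
    by (simp add: norm_mult norm_power powr_mult powr_powr)
  have "(\<integral>\<^sup>+ z. ennreal (norm (A * z ^ n) powr p * exp (- (b * (norm z)\<^sup>2))) \<partial>lborel)
      = (\<integral>\<^sup>+ z. ennreal (norm A powr p) *
           ennreal (norm (z::complex) powr (real n * p) * exp (- (b * (norm z)\<^sup>2))) \<partial>lborel)"
    using AE_lborel_singleton[of "0::complex"]
    by (intro nn_integral_cong_AE) (auto simp: pw ennreal_mult[symmetric] mult_ac elim!: eventually_mono)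
  also have "\<dots> = ennreal (norm A powr p) *
      ennreal (pi * Gamma (1 + real n * p / 2) / b powr (1 + real n * p / 2))"
    using b p by (subst nn_integral_cmult) (auto simp: nn_integral_powr_gaussian)
  finally have "fock_norm_pow \<alpha> p (\<lambda>w. A * w ^ n) = ennreal (b / pi) * (ennreal (norm A powr p) *
      ennreal (pi * Gamma (1 + real n * p / 2) / b powr (1 + real n * p / 2)))"
    by (simp add: fock_norm_pow_lborel b_def)
  also have "\<dots> = ennreal (b / pi * (norm A powr p *
      (pi * Gamma (1 + real n * p / 2) / b powr (1 + real n * p / 2))))"
    using b K by (simp only: ennreal_mult[symmetric] divide_nonneg_pos pi_gt_zero less_imp_le
        powr_ge_zero mult_nonneg_nonneg)
  also have "b / pi * (norm A powr p * (pi * Gamma (1 + real n * p / 2) / b powr (1 + real n * p / 2)))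
      = norm A powr p * (Gamma (1 + real n * p / 2) / b powr (real n * p / 2))"
    using b by (simp add: powr_add)
  finally show ?thesis
    by (simp add: b_def mult.commute)
qed

text \<open>Averaging the weighted integrand over circles keeps its integral and makes it dominate
  that of the Taylor term pointwise. Equal finite integrals then force equality almost
  everywhere.\<close>

lemma fock_norm_pow_ge_taylor_term:
  assumes \<alpha>: "\<alpha> > 0" and p: "p \<ge> 1" and f: "f holomorphic_on UNIV"
    and a: "a = (deriv ^^ n) f 0 / fact n"
  shows "fock_norm_pow \<alpha> p (\<lambda>w. a * w ^ n) \<le> fock_norm_pow \<alpha> p f" (is ?ge)
    and "n \<ge> 1 \<Longrightarrow> fock_norm_pow \<alpha> p (\<lambda>w. a * w ^ n) = fock_norm_pow \<alpha> p f
           \<Longrightarrow> \<exists>A. f = (\<lambda>w. A * w ^ n)"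
proof -
  define w where "w = (\<lambda>z::complex. exp (- (p * \<alpha> / 2 * (norm z)\<^sup>2)))"
  define G where "G = (\<lambda>z. ennreal (norm (f z) powr p * w z))"
  define M where "M = (\<lambda>z. ennreal (norm (a * z ^ n) powr p * w z))"
  define J where "J = (\<lambda>z. integral {0..1} (\<lambda>t. norm (f (z * cis (2 * pi * t))) powr p))"
  define V where "V = (\<lambda>z. \<integral>\<^sup>+ t. G (z * cis (2 * pi * t)) * indicator {0..1} t \<partial>lborel)"
  have cf: "continuous_on UNIV f"
    using f by (rule holomorphic_on_imp_continuous_on)
  have [measurable]: "f \<in> borel_measurable borel" "w \<in> borel_measurable borel"
    using cf unfolding w_def by (auto intro!: borel_measurable_continuous_onI continuous_intros)
  have [measurable]: "G \<in> borel_measurable borel" "M \<in> borel_measurable borel"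
    unfolding G_def M_def by measurable
  have [measurable]: "V \<in> borel_measurable lborel"
    unfolding V_def by (rule nn_integral_lborel_circle_mean(2)) auto
  have VG: "integral\<^sup>N lborel V = integral\<^sup>N lborel G"
    unfolding V_def by (rule nn_integral_lborel_circle_mean(1)) auto
  have w: "w z > 0" for z
    by (simp add: w_def)
  \<comment> \<open>The weight \<open>w\<close> is constant on circles around the origin and so
    factors out of the mean.\<close>
  have V: "V z = ennreal (J z * w z)" for z
  proof -
    have "continuous_on {0..1} (\<lambda>t. norm (f (z * cis (2 * pi * t))) powr p)"
      using p by (intro continuous_on_powr' continuous_intros continuous_on_compose2[OF cf]) auto
    then have "((\<lambda>t. norm (f (z * cis (2 * pi * t))) powr p * w z) has_integral J z * w z) {0..1}"
      unfolding J_def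
      by (intro has_integral_mult_left integrable_integral integrable_continuous_real)
    then have "(\<integral>\<^sup>+ t. ennreal (norm (f (z * cis (2 * pi * t))) powr p * w z) * indicator {0..1} t \<partial>lborel)
       = ennreal (J z * w z)"
      using w[of z] by (intro nn_integral_has_integral_lebesgue') auto
    then show ?thesis
      by (simp add: V_def G_def w_def norm_mult)
  qed
  have MV: "M z \<le> V z" for z
    using circle_mean_powr_ge(1)[OF f p, of "a * z ^ n" n z] w[of z]
    by (auto simp: V M_def J_def a intro!: ennreal_leI mult_right_mono)
  have fnp: "fock_norm_pow \<alpha> p f = ennreal (p * \<alpha> / (2 * pi)) * integral\<^sup>N lborel G"
    "fock_norm_pow \<alpha> p (\<lambda>w. a * w ^ n) = ennreal (p * \<alpha> / (2 * pi)) * integral\<^sup>N lborel M"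
    by (simp_all add: fock_norm_pow_lborel G_def M_def w_def)
  have pos: "p * \<alpha> / (2 * pi) > 0"
    using \<alpha> p by simp
  show ?ge
    unfolding fnp VG[symmetric] by (intro mult_left_mono nn_integral_mono MV) auto
  assume n: "n \<ge> 1" and eq: "fock_norm_pow \<alpha> p (\<lambda>w. a * w ^ n) = fock_norm_pow \<alpha> p f"
  \<comment> \<open>The explicit value for monomials supplies the finiteness needed to pass from
    equal integrals to equality almost everywhere.\<close>
  have "fock_norm_pow \<alpha> p (\<lambda>w. a * w ^ n) \<noteq> \<infinity>"
    using \<alpha> p by (simp add: fock_norm_pow_monomial)
  then have fin: "integral\<^sup>N lborel M \<noteq> \<infinity>"
    unfolding fnp using pos by (auto simp: ennreal_mult_eq_top_iff)
  have "integral\<^sup>N lborel M = integral\<^sup>N lborel V"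
    using eq pos unfolding fnp VG by (auto simp: ennreal_mult_cancel_left)
  then have AE: "AE z in lborel. M z = V z"
    using fin MV by (intro AE_eq_if_nn_integral_eq) auto
  show "\<exists>A. f = (\<lambda>w. A * w ^ n)"
  proof (cases "a = 0")
    case True
    then have "integral\<^sup>N lborel G = 0"
      using \<open>integral\<^sup>N lborel M = integral\<^sup>N lborel V\<close> VG by (simp add: M_def)
    then have "AE z in lborel. G z = 0"
      by (subst (asm) nn_integral_0_iff_AE) auto
    moreover have "f z = 0" if "G z = 0" for z
      using that w[of z] by (auto simp: G_def ennreal_eq_0_iff mult_le_0_iff)
    ultimately have "AE z in lebesgue. z \<in> {z. f z = 0}"
      by (intro AE_completion) (auto elim!: eventually_mono)
    \<comment> \<open>A closed set of full Lebesgue measure is the whole plane, which turns almost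
      everywhere into everywhere.\<close>
    moreover have "closed {z. f z = 0}"
      by (intro closed_Collect_eq cf continuous_intros)
    ultimately have "f z = 0 * z ^ n" for z
      using mem_closed_if_AE_lebesgue by fastforce
    then show ?thesis
      by blast
  next
    case False
    have "AE z in lborel. z \<in> {z. Im (f z * cnj (a * z ^ n)) = 0}"
      using AE
    proof eventually_elim
      case (elim z)
      have "J z \<ge> 0"
        using circle_mean_powr_ge(1)[OF f p refl, of n z] by (auto simp: J_def intro: order_trans[rotated])
      with elim have "norm (a * z ^ n) powr p = J z"
        using w[of z] by (simp add: M_def V)
      then show ?case
        using circle_mean_powr_ge(2)[OF f p, of "a * z ^ n" n z] by (simp add: J_def a)
    qed
    then have "AE z in lebesgue. z \<in> {z. Im (f z * cnj (a * z ^ n)) = 0}"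
      by (rule AE_completion)
    moreover have "closed {z. Im (f z * cnj (a * z ^ n)) = 0}"
      by (intro closed_Collect_eq cf continuous_intros)
    ultimately have "Im (f z * cnj (a * z ^ n)) = 0" for z
      using mem_closed_if_AE_lebesgue by fastforce
    then show ?thesis
      using entire_real_multiple_of_monomial[OF f False n] by blast
  qed
qed

section \<open>The sharp constant and the passage from \<open>p\<close>-th powers to norms\<close>

theorem theorem2p5:
  fixes \<alpha> p :: real and n :: nat
  assumes "\<alpha> > 0" and "1 \<le> p" and "n \<ge> 1"
  shows "(\<forall>f \<in> fock_space \<alpha> p.
            norm ((deriv ^^ n) f 0) \<le>
              (\<alpha> * p) powr (real n / 2) * fact n /
              (2 powr (real n / 2) * Gamma (1 + real n * p / 2) powr (1 / p)) * fock_norm \<alpha> p f)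
       \<and> {f \<in> fock_space \<alpha> p.
            norm ((deriv ^^ n) f 0) =
              (\<alpha> * p) powr (real n / 2) * fact n /
              (2 powr (real n / 2) * Gamma (1 + real n * p / 2) powr (1 / p)) * fock_norm \<alpha> p f}
         = {f. \<exists>A::complex. f = (\<lambda>w. A * w ^ n)}"
proof -
  define C where "C = (\<alpha> * p) powr (real n / 2) * fact n /
      (2 powr (real n / 2) * Gamma (1 + real n * p / 2) powr (1 / p))"
  \<comment> \<open>\<open>Q\<close> is the \<open>p\<close>-th power of the norm of
    \<open>w ^ n\<close>, so \<open>CQ\<close> below says that \<open>C\<close> is
    \<open>fact n\<close> divided by that norm.\<close>
  define Q where "Q = Gamma (1 + real n * p / 2) / (\<alpha> * p / 2) powr (real n * p / 2)"
  have G: "Gamma (1 + real n * p / 2) > 0"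
    using assms by (intro Gamma_real_pos) (auto simp: add_pos_nonneg)
  have Q: "Q > 0"
    using G assms by (simp add: Q_def)
  have C: "C > 0"
    using G assms by (simp add: C_def)
  have CQ: "C * Q powr (1 / p) = fact n"
    using G assms by (simp add: C_def Q_def powr_divide powr_powr powr_mult)
  have pow: "fock_norm_pow \<alpha> p (\<lambda>w. A * w ^ n) = ennreal (norm A powr p * Q)" for A
    using assms by (simp add: fock_norm_pow_monomial Q_def)
  have mono: "C * fock_norm \<alpha> p (\<lambda>w. A * w ^ n) = norm A * fact n" for A
  proof -
    have "fock_norm \<alpha> p (\<lambda>w. A * w ^ n) = norm A * Q powr (1 / p)"
      using Q assms by (simp add: fock_norm_def pow powr_mult powr_powr)
    then show ?thesis
      by (metis CQ mult.left_commute)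
  qed
  have main: "norm ((deriv ^^ n) f 0) \<le> C * fock_norm \<alpha> p f \<and>
      (norm ((deriv ^^ n) f 0) = C * fock_norm \<alpha> p f \<longrightarrow> (\<exists>A. f = (\<lambda>w. A * w ^ n)))"
    if f: "f \<in> fock_space \<alpha> p" for f
  proof -
    define a where "a = (deriv ^^ n) f 0 / fact n"
    have hol: "f holomorphic_on UNIV" and fin: "fock_norm_pow \<alpha> p f < \<infinity>"
      using f by (auto simp: fock_space_def)
    \<comment> \<open>Monomials attain the bound, and \<open>f\<close> has the same derivative at 0
      as its Taylor term; it remains to compare two norms.\<close>
    have d: "norm ((deriv ^^ n) f 0) = C * fock_norm \<alpha> p (\<lambda>w. a * w ^ n)"
      unfolding mono by (simp add: a_def norm_divide)
    \<comment> \<open>Since \<open>enn2real\<close> sends \<open>\<infinity>\<close> to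
      \<open>0\<close>, monotonicity relies on the finite norm of \<open>f\<close>.\<close>
    have "enn2real (fock_norm_pow \<alpha> p (\<lambda>w. a * w ^ n)) \<le> enn2real (fock_norm_pow \<alpha> p f)"
      using fock_norm_pow_ge_taylor_term(1)[OF assms(1,2) hol a_def] fin
      by (intro enn2real_mono) auto
    then have "fock_norm \<alpha> p (\<lambda>w. a * w ^ n) \<le> fock_norm \<alpha> p f"
      unfolding fock_norm_def using assms by (intro powr_mono2) auto
    moreover have "\<exists>A. f = (\<lambda>w. A * w ^ n)"
      if "fock_norm \<alpha> p (\<lambda>w. a * w ^ n) = fock_norm \<alpha> p f"
    proof -
      have "enn2real (fock_norm_pow \<alpha> p (\<lambda>w. a * w ^ n)) = enn2real (fock_norm_pow \<alpha> p f)"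
        using arg_cong[OF that, of "\<lambda>x. x powr p"] assms by (simp add: fock_norm_def powr_powr)
      then have "fock_norm_pow \<alpha> p (\<lambda>w. a * w ^ n) = fock_norm_pow \<alpha> p f"
        using fin by (metis ennreal_enn2real ennreal_less_top infinity_ennreal_def pow)
      then show ?thesis
        using fock_norm_pow_ge_taylor_term(2)[OF assms(1,2) hol a_def assms(3)] by blast
    qed
    ultimately show ?thesis
      using C unfolding d by (simp add: mult_le_cancel_left_pos)
  qed
  \<comment> \<open>The converse inclusion, with \<open>A = 0\<close> giving the zero
    function.\<close>
  have conv: "(\<lambda>w. A * w ^ n) \<in> fock_space \<alpha> p \<and>
      norm ((deriv ^^ n) (\<lambda>w. A * w ^ n) 0) = C * fock_norm \<alpha> p (\<lambda>w. A * w ^ n)" for A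
    by (auto simp: fock_space_def pow mono higher_deriv_monomial_0 norm_mult intro!: holomorphic_intros)
  show ?thesis
    unfolding C_def[symmetric] using main conv by blast
qed

end
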